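(* Let $F\dashv G:\mathcal{D}\to\mathcal{C}$ be an adjunction with $G$ a semiseparable functor, and let $e:\mathrm{Id}_{\mathcal{D}}\to\mathrm{Id}_{\mathcal{D}}$ be the idempotent natural transformation associated to $G$. Then the composite functor $K_{GF}\circ L_{GF}:GF\text{-}\mathrm{Free}_{\mathcal{C}}\to\mathcal{C}_{GF}$ is an equivalence up to retracts. Moreover, also the composite $H\circ L_{GF}:GF\text{-}\mathrm{Free}_{\mathcal{C}}\to\mathcal{D}_e$ is an equivalence up to retracts, and hence there are equivalences of categories $(GF\text{-}\mathrm{Free}_{\mathcal{C}})^\natural\cong(\mathcal{D}_e)^\natural\cong(\mathcal{C}_{GF})^\natural$.
   Context: Here $F:\mathcal{C}\to\mathcal{D}$ is left adjoint to $G:\mathcal{D}\to\mathcal{C}$, with unit $\eta$ and counit $\epsilon$. $G$ is semiseparable if there is a natural transformation $\mathcal{P}:\mathrm{Hom}_{\mathcal{C}}(G-,G-)\to\mathrm{Hom}_{\mathcal{D}}(-,-)$ with $\mathcal{G}\circ\mathcal{P}\circ\mathcal{G}=\mathcal{G}$, where $\mathcal{G}_{X,Y}(f)=G(f)$. Its associated idempotent natural transformation $e:\mathrm{Id}_{\mathcal{D}}\to\mathrm{Id}_{\mathcal{D}}$ is $e_X=\mathcal{P}_{X,X}(\mathrm{Id}_{GX})$ for any such $\mathcal{P}$; it is the unique idempotent natural transformation with $Ge=\mathrm{Id}_G$ such that for $f,g:A\to B$ in $\mathcal{D}$ one has $Gf=Gg$ iff $e_B\circ f=e_B\circ g$. The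 coidentifier $\mathcal{D}_e$ is the quotient category $\mathcal{D}/\!\sim$ with the same objects, where $f\sim g$ (for $f,g:A\to B$) iff $e_B\circ f=e_B\circ g$; $H:\mathcal{D}\to\mathcal{D}_e$ is the quotient functor. $\mathcal{C}_{GF}$ is the Eilenberg–Moore category of modules over the monad $(GF,G\epsilon F,\eta)$, and $K_{GF}:\mathcal{D}\to\mathcal{C}_{GF}$, $D\mapsto(GD,G\epsilon_D)$, $f\mapsto G(f)$, is the comparison functor. $GF\text{-}\mathrm{Free}_{\mathcal{C}}$ is the Kleisli category of this monad: its objects are those of $\mathcal{C}$; a morphism $f:C\nrightarrow D$ is a morphism $f:C\to GFD$ in $\mathcal{C}$; the composite of $f:C\nrightarrow D$ and $g:D\nrightarrow E$ is $G\epsilon_{FE}\circ GF(g)\circ f$; the identity on $C$ is $\eta_C$. The Kleisli comparison functor is $L_{GF}:GF\text{-}\mathrm{Free}_{\mathcal{C}}\to\mathcal{D}$, $C\mapsto FC$, $(f:C\nrightarrow D)\mapsto\epsilon_{FD}\circ F(f)$. The idempotent completion $\mathcal{A}^\natural$ of a category $\mathcal{A}$ has as objects the pairs $(X,e)$ with $e:X\to X$ idempotent in $\mathcal{A}$; a morphism $f:(X,e)\to(X',e')$ is a morphism $f:X\to X'$ with $f=e'\circ f\circ e$, and $\mathrm{Id}_{(X,e)}=e$. A functor $T:\mathcal{A}\to\mathcal{B}$ induces $T^\natural:\mathcal{A}^\natural\to\mathcal{B}^\natural$, $T^\natural(X,e)=(TX,Te)$, $T^\natural(f)=T(f)$, and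 $T$ is an equivalence up to retracts if $T^\natural$ is an equivalence. *)

theory Defs
  imports Main
begin

section \<open>Categories, functors, natural transformations\<close>

text \<open>
  A category has a set of objects and, for any two objects, a set of morphisms. Hom-sets of
  different pairs of objects are not required to be disjoint (in the Kleisli, Eilenberg-Moore and
  idempotent completion categories one raw morphism may have several sources and targets).
  Therefore composition, and the action of a functor on morphisms, take the objects involved as
  arguments: \<open>Comp C X Y Z g f\<close> is the composite of \<open>f : X \<rightarrow> Y\<close> and
  \<open>g : Y \<rightarrow> Z\<close>. All operations are unconstrained outside their intended domains.
\<close>

record ('o, 'm) cat =
  Obj :: "'o set"
  Hom :: "'o \<Rightarrow> 'o \<Rightarrow> 'm set"
  Idn :: "'o \<Rightarrow> 'm"
  Comp :: "'o \<Rightarrow> 'o \<Rightarrow> 'o \<Rightarrow> 'm \<Rightarrow> 'm \<Rightarrow> 'm"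

locale category =
  fixes C :: "('o, 'm) cat"
  assumes Idn_in_Hom: "X \<in> Obj C \<Longrightarrow> Idn C X \<in> Hom C X X"
    and Comp_in_Hom:
      "\<lbrakk>X \<in> Obj C; Y \<in> Obj C; Z \<in> Obj C; f \<in> Hom C X Y; g \<in> Hom C Y Z\<rbrakk>
        \<Longrightarrow> Comp C X Y Z g f \<in> Hom C X Z"
    and Comp_Idn_left:
      "\<lbrakk>X \<in> Obj C; Y \<in> Obj C; f \<in> Hom C X Y\<rbrakk> \<Longrightarrow> Comp C X Y Y (Idn C Y) f = f"
    and Comp_Idn_right:
      "\<lbrakk>X \<in> Obj C; Y \<in> Obj C; f \<in> Hom C X Y\<rbrakk> \<Longrightarrow> Comp C X X Y f (Idn C X) = f"
    and Comp_assoc: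
      "\<lbrakk>W \<in> Obj C; X \<in> Obj C; Y \<in> Obj C; Z \<in> Obj C;
        f \<in> Hom C W X; g \<in> Hom C X Y; h \<in> Hom C Y Z\<rbrakk>
        \<Longrightarrow> Comp C W Y Z h (Comp C W X Y g f) = Comp C W X Z (Comp C X Y Z h g) f"

record ('o, 'm, 'p, 'n) fctr =
  Ob :: "'o \<Rightarrow> 'p"
  Mor :: "'o \<Rightarrow> 'o \<Rightarrow> 'm \<Rightarrow> 'n"

locale cat_functor = A: category A + B: category B
  for A :: "('o, 'm) cat" and B :: "('p, 'n) cat" +
  fixes T :: "('o, 'm, 'p, 'n) fctr"
  assumes Ob_in_Obj: "X \<in> Obj A \<Longrightarrow> Ob T X \<in> Obj B"
    and Mor_in_Hom:
      "\<lbrakk>X \<in> Obj A; Y \<in> Obj A; f \<in> Hom A X Y\<rbrakk> \<Longrightarrow> Mor T X Y f \<in> Hom B (Ob T X) (Ob T Y)"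
    and Mor_Idn: "X \<in> Obj A \<Longrightarrow> Mor T X X (Idn A X) = Idn B (Ob T X)"
    and Mor_Comp:
      "\<lbrakk>X \<in> Obj A; Y \<in> Obj A; Z \<in> Obj A; f \<in> Hom A X Y; g \<in> Hom A Y Z\<rbrakk>
        \<Longrightarrow> Mor T X Z (Comp A X Y Z g f)
            = Comp B (Ob T X) (Ob T Y) (Ob T Z) (Mor T Y Z g) (Mor T X Y f)"

definition id_fctr :: "('o, 'm, 'o, 'm) fctr" where
  "id_fctr = \<lparr>Ob = (\<lambda>X. X), Mor = (\<lambda>X Y f. f)\<rparr>"

definition comp_fctr ::
    "('p, 'n, 'q, 'k) fctr \<Rightarrow> ('o, 'm, 'p, 'n) fctr \<Rightarrow> ('o, 'm, 'q, 'k) fctr" where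
  "comp_fctr S T =
     \<lparr>Ob = (\<lambda>X. Ob S (Ob T X)), Mor = (\<lambda>X Y f. Mor S (Ob T X) (Ob T Y) (Mor T X Y f))\<rparr>"

locale nat_trans = S: cat_functor A B S + T: cat_functor A B T
  for A :: "('o, 'm) cat" and B :: "('p, 'n) cat" and S T :: "('o, 'm, 'p, 'n) fctr" +
  fixes \<tau> :: "'o \<Rightarrow> 'n"
  assumes component_in_Hom: "X \<in> Obj A \<Longrightarrow> \<tau> X \<in> Hom B (Ob S X) (Ob T X)"
    and naturality:
      "\<lbrakk>X \<in> Obj A; Y \<in> Obj A; f \<in> Hom A X Y\<rbrakk>
        \<Longrightarrow> Comp B (Ob S X) (Ob S Y) (Ob T Y) (\<tau> Y) (Mor S X Y f)
            = Comp B (Ob S X) (Ob T X) (Ob T Y) (Mor T X Y f) (\<tau> X)"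

definition is_iso :: "('o, 'm) cat \<Rightarrow> 'o \<Rightarrow> 'o \<Rightarrow> 'm \<Rightarrow> bool" where
  "is_iso C X Y f \<longleftrightarrow> f \<in> Hom C X Y \<and>
     (\<exists>g \<in> Hom C Y X. Comp C X Y X g f = Idn C X \<and> Comp C Y X Y f g = Idn C Y)"

definition naturally_isomorphic ::
    "('o, 'm) cat \<Rightarrow> ('p, 'n) cat \<Rightarrow> ('o, 'm, 'p, 'n) fctr \<Rightarrow> ('o, 'm, 'p, 'n) fctr \<Rightarrow> bool" where
  "naturally_isomorphic A B S T \<longleftrightarrow>
     (\<exists>\<tau>. nat_trans A B S T \<tau> \<and> (\<forall>X \<in> Obj A. is_iso B (Ob S X) (Ob T X) (\<tau> X)))"

definition equivalence ::
    "('o, 'm) cat \<Rightarrow> ('p, 'n) cat \<Rightarrow> ('o, 'm, 'p, 'n) fctr \<Rightarrow> bool" where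
  "equivalence A B T \<longleftrightarrow> cat_functor A B T \<and>
     (\<exists>S. cat_functor B A S \<and>
          naturally_isomorphic A A (comp_fctr S T) id_fctr \<and>
          naturally_isomorphic B B (comp_fctr T S) id_fctr)"

definition equivalent_categories :: "('o, 'm) cat \<Rightarrow> ('p, 'n) cat \<Rightarrow> bool" where
  "equivalent_categories A B \<longleftrightarrow> (\<exists>T. equivalence A B T)"


section \<open>Idempotent completion\<close>

definition idem_completion :: "('o, 'm) cat \<Rightarrow> ('o \<times> 'm, 'm) cat" where
  "idem_completion A =
     \<lparr>Obj = {(X, p). X \<in> Obj A \<and> p \<in> Hom A X X \<and> Comp A X X X p p = p},
      Hom = (\<lambda>(X, p) (X', p').
               {f \<in> Hom A X X'. f = Comp A X X' X' p' (Comp A X X X' f p)}),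
      Idn = (\<lambda>(X, p). p),
      Comp = (\<lambda>(X, p) (Y, q) (Z, r). Comp A X Y Z)\<rparr>"

definition idem_completion_fctr ::
    "('o, 'm, 'p, 'n) fctr \<Rightarrow> ('o \<times> 'm, 'm, 'p \<times> 'n, 'n) fctr" where
  "idem_completion_fctr T =
     \<lparr>Ob = (\<lambda>(X, p). (Ob T X, Mor T X X p)), Mor = (\<lambda>(X, p) (Y, q). Mor T X Y)\<rparr>"

definition equivalence_up_to_retracts ::
    "('o, 'm) cat \<Rightarrow> ('p, 'n) cat \<Rightarrow> ('o, 'm, 'p, 'n) fctr \<Rightarrow> bool" where
  "equivalence_up_to_retracts A B T \<longleftrightarrow> cat_functor A B T \<and>
     equivalence (idem_completion A) (idem_completion B) (idem_completion_fctr T)"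


section \<open>Adjunctions, Kleisli and Eilenberg-Moore categories\<close>

locale adjunction =
  F: cat_functor C D F + G: cat_functor D C G +
  unit: nat_trans C C id_fctr "comp_fctr G F" \<eta> +
  counit: nat_trans D D "comp_fctr F G" id_fctr \<epsilon>
  for C :: "('o, 'm) cat" and D :: "('p, 'n) cat"
    and F :: "('o, 'm, 'p, 'n) fctr" and G :: "('p, 'n, 'o, 'm) fctr"
    and \<eta> :: "'o \<Rightarrow> 'm" and \<epsilon> :: "'p \<Rightarrow> 'n" +
  assumes triangle_F:
      "X \<in> Obj C \<Longrightarrow>
        Comp D (Ob F X) (Ob F (Ob G (Ob F X))) (Ob F X)
          (\<epsilon> (Ob F X)) (Mor F X (Ob G (Ob F X)) (\<eta> X)) = Idn D (Ob F X)"
    and triangle_G: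
      "Y \<in> Obj D \<Longrightarrow>
        Comp C (Ob G Y) (Ob G (Ob F (Ob G Y))) (Ob G Y)
          (Mor G (Ob F (Ob G Y)) Y (\<epsilon> Y)) (\<eta> (Ob G Y)) = Idn C (Ob G Y)"

text \<open>
  The multiplication \<open>G \<epsilon> F\<close> of the monad \<open>GF\<close> induced by an adjunction.
\<close>

definition adj_mult ::
    "('o, 'm, 'p, 'n) fctr \<Rightarrow> ('p, 'n, 'o, 'm) fctr \<Rightarrow> ('p \<Rightarrow> 'n) \<Rightarrow> 'o \<Rightarrow> 'm" where
  "adj_mult F G \<epsilon> X = Mor G (Ob F (Ob G (Ob F X))) (Ob F X) (\<epsilon> (Ob F X))"

definition Kleisli ::
    "('o, 'm) cat \<Rightarrow> ('o, 'm, 'o, 'm) fctr \<Rightarrow> ('o \<Rightarrow> 'm) \<Rightarrow> ('o \<Rightarrow> 'm) \<Rightarrow> ('o, 'm) cat" where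
  "Kleisli C T \<mu> \<eta> =
     \<lparr>Obj = Obj C,
      Hom = (\<lambda>X Y. Hom C X (Ob T Y)),
      Idn = \<eta>,
      Comp = (\<lambda>X Y Z g f.
                Comp C X (Ob T (Ob T Z)) (Ob T Z) (\<mu> Z)
                  (Comp C X (Ob T Y) (Ob T (Ob T Z)) (Mor T Y (Ob T Z) g) f))\<rparr>"

definition Eilenberg_Moore ::
    "('o, 'm) cat \<Rightarrow> ('o, 'm, 'o, 'm) fctr \<Rightarrow> ('o \<Rightarrow> 'm) \<Rightarrow> ('o \<Rightarrow> 'm) \<Rightarrow> ('o \<times> 'm, 'm) cat" where
  "Eilenberg_Moore C T \<mu> \<eta> =
     \<lparr>Obj = {(X, a). X \<in> Obj C \<and> a \<in> Hom C (Ob T X) X \<and>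
               Comp C (Ob T (Ob T X)) (Ob T X) X a (Mor T (Ob T X) X a)
                 = Comp C (Ob T (Ob T X)) (Ob T X) X a (\<mu> X) \<and>
               Comp C X (Ob T X) X a (\<eta> X) = Idn C X},
      Hom = (\<lambda>(X, a) (Y, b).
               {f \<in> Hom C X Y.
                  Comp C (Ob T X) X Y f a = Comp C (Ob T X) (Ob T Y) Y b (Mor T X Y f)}),
      Idn = (\<lambda>(X, a). Idn C X),
      Comp = (\<lambda>(X, a) (Y, b) (Z, c). Comp C X Y Z)\<rparr>"

definition GF_Free ::
    "('o, 'm) cat \<Rightarrow> ('o, 'm, 'p, 'n) fctr \<Rightarrow> ('p, 'n, 'o, 'm) fctr \<Rightarrow>
     ('o \<Rightarrow> 'm) \<Rightarrow> ('p \<Rightarrow> 'n) \<Rightarrow> ('o, 'm) cat" where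
  "GF_Free C F G \<eta> \<epsilon> = Kleisli C (comp_fctr G F) (adj_mult F G \<epsilon>) \<eta>"

definition GF_Mod ::
    "('o, 'm) cat \<Rightarrow> ('o, 'm, 'p, 'n) fctr \<Rightarrow> ('p, 'n, 'o, 'm) fctr \<Rightarrow>
     ('o \<Rightarrow> 'm) \<Rightarrow> ('p \<Rightarrow> 'n) \<Rightarrow> ('o \<times> 'm, 'm) cat" where
  "GF_Mod C F G \<eta> \<epsilon> = Eilenberg_Moore C (comp_fctr G F) (adj_mult F G \<epsilon>) \<eta>"

definition comparison_K ::
    "('o, 'm, 'p, 'n) fctr \<Rightarrow> ('p, 'n, 'o, 'm) fctr \<Rightarrow> ('p \<Rightarrow> 'n) \<Rightarrow>
     ('p, 'n, 'o \<times> 'm, 'm) fctr" where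
  "comparison_K F G \<epsilon> =
     \<lparr>Ob = (\<lambda>Y. (Ob G Y, Mor G (Ob F (Ob G Y)) Y (\<epsilon> Y))), Mor = Mor G\<rparr>"

definition comparison_L ::
    "('p, 'n) cat \<Rightarrow> ('o, 'm, 'p, 'n) fctr \<Rightarrow> ('p, 'n, 'o, 'm) fctr \<Rightarrow> ('p \<Rightarrow> 'n) \<Rightarrow>
     ('o, 'm, 'p, 'n) fctr" where
  "comparison_L D F G \<epsilon> =
     \<lparr>Ob = Ob F,
      Mor = (\<lambda>X Y f.
               Comp D (Ob F X) (Ob F (Ob G (Ob F Y))) (Ob F Y)
                 (\<epsilon> (Ob F Y)) (Mor F X (Ob G (Ob F Y)) f))\<rparr>"


section \<open>Semiseparable functors and the coidentifier\<close>

text \<open>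
  \<open>P\<close> is a natural transformation of functors \<open>D\<^sup>o\<^sup>p \<times> D \<rightarrow> Set\<close> from
  \<open>Hom\<^sub>C(G-, G-)\<close> to \<open>Hom\<^sub>D(-, -)\<close>.
\<close>

definition hom_nat_trans ::
    "('p, 'n) cat \<Rightarrow> ('o, 'm) cat \<Rightarrow> ('p, 'n, 'o, 'm) fctr \<Rightarrow> ('p \<Rightarrow> 'p \<Rightarrow> 'm \<Rightarrow> 'n) \<Rightarrow> bool" where
  "hom_nat_trans D C G P \<longleftrightarrow>
     (\<forall>X \<in> Obj D. \<forall>Y \<in> Obj D. \<forall>h \<in> Hom C (Ob G X) (Ob G Y). P X Y h \<in> Hom D X Y) \<and>
     (\<forall>X \<in> Obj D. \<forall>Y \<in> Obj D. \<forall>X' \<in> Obj D. \<forall>Y' \<in> Obj D.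
        \<forall>f \<in> Hom D X' X. \<forall>g \<in> Hom D Y Y'. \<forall>h \<in> Hom C (Ob G X) (Ob G Y).
          P X' Y' (Comp C (Ob G X') (Ob G Y) (Ob G Y') (Mor G Y Y' g)
                     (Comp C (Ob G X') (Ob G X) (Ob G Y) h (Mor G X' X f)))
          = Comp D X' Y Y' g (Comp D X' X Y (P X Y h) f))"

definition semiseparability_witness ::
    "('p, 'n) cat \<Rightarrow> ('o, 'm) cat \<Rightarrow> ('p, 'n, 'o, 'm) fctr \<Rightarrow> ('p \<Rightarrow> 'p \<Rightarrow> 'm \<Rightarrow> 'n) \<Rightarrow> bool" where
  "semiseparability_witness D C G P \<longleftrightarrow> hom_nat_trans D C G P \<and>
     (\<forall>X \<in> Obj D. \<forall>Y \<in> Obj D. \<forall>f \<in> Hom D X Y.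
        Mor G X Y (P X Y (Mor G X Y f)) = Mor G X Y f)"

definition semiseparable ::
    "('p, 'n) cat \<Rightarrow> ('o, 'm) cat \<Rightarrow> ('p, 'n, 'o, 'm) fctr \<Rightarrow> bool" where
  "semiseparable D C G \<longleftrightarrow> cat_functor D C G \<and> (\<exists>P. semiseparability_witness D C G P)"

text \<open>
  The components of \<open>e\<close> do not depend on the choice of \<open>P\<close>; see
  \<open>associated_idempotent_unique\<close> below.
\<close>

definition associated_idempotent ::
    "('p, 'n) cat \<Rightarrow> ('o, 'm) cat \<Rightarrow> ('p, 'n, 'o, 'm) fctr \<Rightarrow> ('p \<Rightarrow> 'n) \<Rightarrow> bool" where
  "associated_idempotent D C G e \<longleftrightarrow>
     (\<exists>P. semiseparability_witness D C G P \<and> (\<forall>X \<in> Obj D. e X = P X X (Idn C (Ob G X))))"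

lemma associated_idempotent_unique:
  assumes G: "cat_functor D C G"
    and e: "associated_idempotent D C G e" and e': "associated_idempotent D C G e'"
    and X: "X \<in> Obj D"
  shows "e X = e' X"
proof -
  interpret cat_functor D C G by (rule G)
  have key: "a X = Comp D X X X (a X) (b X)" "a X = Comp D X X X (b X) (a X)"
    if a: "associated_idempotent D C G a" and b: "associated_idempotent D C G b" for a b
  proof -
    let ?I = "Idn C (Ob G X)"
    have I: "?I \<in> Hom C (Ob G X) (Ob G X)" "Ob G X \<in> Obj C"
      using X by (auto intro: B.Idn_in_Hom Ob_in_Obj)
    obtain P where P: "semiseparability_witness D C G P" and aP: "a X = P X X ?I"
      using a X by (auto simp: associated_idempotent_def)
    obtain Q where Q: "semiseparability_witness D C G Q" and bQ: "b X = Q X X ?I"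
      using b X by (auto simp: associated_idempotent_def)
    have aH: "a X \<in> Hom D X X"
      using P X I by (auto simp: aP semiseparability_witness_def hom_nat_trans_def)
    have bH: "b X \<in> Hom D X X"
      using Q X I by (auto simp: bQ semiseparability_witness_def hom_nat_trans_def)
    have Gb: "Mor G X X (b X) = ?I"
      using Q X A.Idn_in_Hom[OF X] Mor_Idn[OF X]
      unfolding semiseparability_witness_def bQ by metis
    have nat: "P X X (Comp C (Ob G X) (Ob G X) (Ob G X) (Mor G X X g)
                  (Comp C (Ob G X) (Ob G X) (Ob G X) ?I (Mor G X X f)))
               = Comp D X X X g (Comp D X X X (P X X ?I) f)"
      if "f \<in> Hom D X X" "g \<in> Hom D X X" for f g
      using P X I that by (auto simp: semiseparability_witness_def hom_nat_trans_def)
    show "a X = Comp D X X X (a X) (b X)"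
      using nat[OF bH A.Idn_in_Hom[OF X]] X I aH bH
      by (simp add: Gb Mor_Idn B.Comp_Idn_left A.Comp_Idn_left A.Comp_in_Hom flip: aP)
    show "a X = Comp D X X X (b X) (a X)"
      using nat[OF A.Idn_in_Hom[OF X] bH] X I aH bH
      by (simp add: Gb Mor_Idn B.Comp_Idn_left A.Comp_Idn_right A.Comp_in_Hom flip: aP)
  qed
  show ?thesis using key(1)[OF e e'] key(2)[OF e' e] by simp
qed

definition quotient_cat :: "('p, 'n) cat \<Rightarrow> ('p \<Rightarrow> 'p \<Rightarrow> 'n rel) \<Rightarrow> ('p, 'n set) cat" where
  "quotient_cat D r =
     \<lparr>Obj = Obj D,
      Hom = (\<lambda>X Y. Hom D X Y // r X Y),
      Idn = (\<lambda>X. r X X `` {Idn D X}),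
      Comp = (\<lambda>X Y Z \<psi> \<phi>. \<Union>g\<in>\<psi>. \<Union>f\<in>\<phi>. r X Z `` {Comp D X Y Z g f})\<rparr>"

definition quotient_fctr :: "('p \<Rightarrow> 'p \<Rightarrow> 'n rel) \<Rightarrow> ('p, 'n, 'p, 'n set) fctr" where
  "quotient_fctr r = \<lparr>Ob = (\<lambda>X. X), Mor = (\<lambda>X Y f. r X Y `` {f})\<rparr>"

definition coidentifier_rel :: "('p, 'n) cat \<Rightarrow> ('p \<Rightarrow> 'n) \<Rightarrow> 'p \<Rightarrow> 'p \<Rightarrow> 'n rel" where
  "coidentifier_rel D e X Y =
     {(f, g). f \<in> Hom D X Y \<and> g \<in> Hom D X Y \<and> Comp D X Y Y (e Y) f = Comp D X Y Y (e Y) g}"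

definition coidentifier :: "('p, 'n) cat \<Rightarrow> ('p \<Rightarrow> 'n) \<Rightarrow> ('p, 'n set) cat" where
  "coidentifier D e = quotient_cat D (coidentifier_rel D e)"

definition coidentifier_fctr :: "('p, 'n) cat \<Rightarrow> ('p \<Rightarrow> 'n) \<Rightarrow> ('p, 'n, 'p, 'n set) fctr" where
  "coidentifier_fctr D e = quotient_fctr (coidentifier_rel D e)"

end

theory Submission
  imports Defs
begin

text \<open>
  A fully faithful functor \<open>T\<close> such that every object of the target is a retract of some \<open>T X\<close> is an
  equivalence up to retracts: a splitting of \<open>Y\<close> off \<open>T X\<close> turns an idempotent of \<open>Y\<close> into one of
  \<open>T X\<close>, which lifts along \<open>T\<close>. We apply this to \<open>K \<circ> L\<close>, to \<open>H \<circ> L\<close> and to the functor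
  \<open>D\<^sub>e \<rightarrow> C\<^sub>G\<^sub>F\<close> induced by \<open>K\<close>; the last one gives the second equivalence of completions directly.
  The retractions come from \<open>\<chi> Y = P (\<eta> (G Y)) : Y \<rightarrow> F G Y\<close>, which is natural in \<open>Y\<close> and satisfies
  \<open>\<epsilon> Y \<circ> \<chi> Y = e Y\<close>, a morphism that both \<open>G\<close> and \<open>H\<close> send to an identity.
\<close>

section \<open>Normal forms of composites in a category\<close>

context category
begin

lemmas cat_simps [simp] = Idn_in_Hom Comp_in_Hom Comp_Idn_left Comp_Idn_right

text \<open>Oriented so that composites become nested to the right, \<open>h (g f)\<close>; all
  later rewriting assumes this normal form.\<close>

lemmas Comp_assoc' [simp] = Comp_assoc [symmetric]

text \<open>In a right-nested chain an equation between two-step composites matches only at the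
  innermost end. The extra factor \<open>f\<close> makes it applicable at every other
  position.\<close>

lemma Comp_square:
  assumes "Comp C X Y Z h g = Comp C X Y' Z h' g'"
    and "W \<in> Obj C" "X \<in> Obj C" "Y \<in> Obj C" "Y' \<in> Obj C" "Z \<in> Obj C"
    and "f \<in> Hom C W X" "g \<in> Hom C X Y" "h \<in> Hom C Y Z" "g' \<in> Hom C X Y'" "h' \<in> Hom C Y' Z"
  shows "Comp C W Y Z h (Comp C W X Y g f) = Comp C W Y' Z h' (Comp C W X Y' g' f)"
  using assms by (simp add: Comp_assoc del: Comp_assoc')

text \<open>The counterpart of \<open>Comp_square\<close> for equations whose right side is an
  identity.\<close>

lemma Comp_cancel:
  assumes "Comp C X Y X h g = Idn C X"
    and "W \<in> Obj C" "X \<in> Obj C" "Y \<in> Obj C"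
    and "f \<in> Hom C W X" "g \<in> Hom C X Y" "h \<in> Hom C Y X"
  shows "Comp C W Y X h (Comp C W X Y g f) = f"
  using assms by (simp add: Comp_assoc del: Comp_assoc')

end

context cat_functor
begin

lemmas functor_simps [simp] = Ob_in_Obj Mor_in_Hom Mor_Idn Mor_Comp

end

lemma id_fctr_simps [simp]: "Ob id_fctr X = X" "Mor id_fctr X Y f = f"
  by (simp_all add: id_fctr_def)

lemma comp_fctr_simps [simp]:
  "Ob (comp_fctr S T) X = Ob S (Ob T X)"
  "Mor (comp_fctr S T) X Y f = Mor S (Ob T X) (Ob T Y) (Mor T X Y f)"
  by (simp_all add: comp_fctr_def)

lemma (in category) cat_functor_id: "cat_functor C C id_fctr"
  by unfold_locales simp_all

lemma cat_functor_comp: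
  assumes "cat_functor A B T" "cat_functor B C S"
  shows "cat_functor A C (comp_fctr S T)"
proof -
  interpret T: cat_functor A B T by fact
  interpret S: cat_functor B C S by fact
  show ?thesis by unfold_locales simp_all
qed


section \<open>Fully faithful functors that are surjective up to retracts\<close>

definition fully_faithful ::
    "('o, 'm) cat \<Rightarrow> ('p, 'n) cat \<Rightarrow> ('o, 'm, 'p, 'n) fctr \<Rightarrow> bool" where
  "fully_faithful A B T \<longleftrightarrow>
     (\<forall>X \<in> Obj A. \<forall>Y \<in> Obj A. bij_betw (Mor T X Y) (Hom A X Y) (Hom B (Ob T X) (Ob T Y)))"

lemma fully_faithfulI:
  assumes "cat_functor A B T"
    and "\<And>X Y f g. \<lbrakk>X \<in> Obj A; Y \<in> Obj A; f \<in> Hom A X Y; g \<in> Hom A X Y; Mor T X Y f = Mor T X Y g\<rbrakk> \<Longrightarrow> f = g"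
    and "\<And>X Y h. \<lbrakk>X \<in> Obj A; Y \<in> Obj A; h \<in> Hom B (Ob T X) (Ob T Y)\<rbrakk> \<Longrightarrow> \<exists>f \<in> Hom A X Y. Mor T X Y f = h"
  shows "fully_faithful A B T"
proof -
  interpret cat_functor A B T by fact
  show ?thesis
    unfolding fully_faithful_def bij_betw_def inj_on_def using assms(2,3) by fastforce
qed

lemma fully_faithful_inj:
  assumes "fully_faithful A B T" "X \<in> Obj A" "Y \<in> Obj A" "f \<in> Hom A X Y" "g \<in> Hom A X Y"
    and "Mor T X Y f = Mor T X Y g"
  shows "f = g"
  using assms by (meson bij_betw_imp_inj_on fully_faithful_def inj_onD)

lemma fully_faithful_surj:
  assumes "fully_faithful A B T" "X \<in> Obj A" "Y \<in> Obj A" "h \<in> Hom B (Ob T X) (Ob T Y)"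
  obtains f where "f \<in> Hom A X Y" "Mor T X Y f = h"
  using assms unfolding fully_faithful_def by (metis bij_betw_imp_surj_on imageE)

text \<open>The quasi-inverse comes from choice: for each \<open>Y\<close> an isomorphism
  \<open>u Y\<close> from \<open>T (s Y)\<close> with inverse \<open>v Y\<close>. Morphisms are
  conjugated by these and lifted along \<open>T\<close>; equations in \<open>A\<close> are checked
  after applying \<open>T\<close>.\<close>

lemma fully_faithful_ess_surj_equivalence:
  assumes T: "cat_functor A B T" and ff: "fully_faithful A B T"
    and es: "\<And>Y. Y \<in> Obj B \<Longrightarrow> \<exists>X \<in> Obj A. \<exists>f. is_iso B (Ob T X) Y f"
  shows "equivalence A B T"
proof -
  interpret cat_functor A B T by (rule T)
  obtain s u v where s: "\<And>Y. Y \<in> Obj B \<Longrightarrow> s Y \<in> Obj A"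
    and u: "\<And>Y. Y \<in> Obj B \<Longrightarrow> u Y \<in> Hom B (Ob T (s Y)) Y"
    and v: "\<And>Y. Y \<in> Obj B \<Longrightarrow> v Y \<in> Hom B Y (Ob T (s Y))"
    and vu: "\<And>Y. Y \<in> Obj B \<Longrightarrow> Comp B (Ob T (s Y)) Y (Ob T (s Y)) (v Y) (u Y) = Idn B (Ob T (s Y))"
    and uv: "\<And>Y. Y \<in> Obj B \<Longrightarrow> Comp B Y (Ob T (s Y)) Y (u Y) (v Y) = Idn B Y"
    using es unfolding is_iso_def by metis
  define inv where "inv X Y h = (SOME f. f \<in> Hom A X Y \<and> Mor T X Y f = h)" for X Y h
  have inv: "inv X Y h \<in> Hom A X Y" "Mor T X Y (inv X Y h) = h"
    if "X \<in> Obj A" "Y \<in> Obj A" "h \<in> Hom B (Ob T X) (Ob T Y)" for X Y h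
    using someI_ex[of "\<lambda>f. f \<in> Hom A X Y \<and> Mor T X Y f = h"] fully_faithful_surj[OF ff that]
    unfolding inv_def by blast+
  note [simp] = s u v vu uv inv
    B.Comp_cancel[OF vu] B.Comp_cancel[OF uv]
  define S where "S = \<lparr>Ob = s, Mor = (\<lambda>Y Y' f. inv (s Y) (s Y')
      (Comp B (Ob T (s Y)) Y' (Ob T (s Y')) (v Y') (Comp B (Ob T (s Y)) Y Y' f (u Y))))\<rparr>"
  have [simp]: "Ob S = s" "\<And>Y Y' f. Mor S Y Y' f = inv (s Y) (s Y')
      (Comp B (Ob T (s Y)) Y' (Ob T (s Y')) (v Y') (Comp B (Ob T (s Y)) Y Y' f (u Y)))"
    by (simp_all add: S_def)
  have S: "cat_functor B A S"
  proof unfold_locales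
    fix X assume "X \<in> Obj B"
    then show "Mor S X X (Idn B X) = Idn A (Ob S X)"
      by (intro fully_faithful_inj[OF ff, of "s X" "s X"]) simp_all
  next
    fix X Y Z f g assume "X \<in> Obj B" "Y \<in> Obj B" "Z \<in> Obj B" "f \<in> Hom B X Y" "g \<in> Hom B Y Z"
    then show "Mor S X Z (Comp B X Y Z g f)
        = Comp A (Ob S X) (Ob S Y) (Ob S Z) (Mor S Y Z g) (Mor S X Y f)"
      by (intro fully_faithful_inj[OF ff, of "s X" "s Z"]) simp_all
  qed simp_all
  interpret S: cat_functor B A S by (rule S)
  have "nat_trans B B (comp_fctr T S) id_fctr u"
    by (intro nat_trans.intro nat_trans_axioms.intro cat_functor_comp[OF S T] B.cat_functor_id) simp_all
  moreover have "is_iso B (Ob T (s Y)) Y (u Y)" if "Y \<in> Obj B" for Y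
    using that unfolding is_iso_def by (auto intro!: bexI[of _ "v Y"])
  ultimately have TS: "naturally_isomorphic B B (comp_fctr T S) id_fctr"
    unfolding naturally_isomorphic_def by (auto intro!: exI[of _ u])
  \<comment> \<open>The isomorphism for the other composite is the lift of \<open>u\<close> at
    \<open>T X\<close>; its inverse is the lift of \<open>v\<close>.\<close>
  define w where "w X = inv (s (Ob T X)) X (u (Ob T X))" for X
  have [simp]: "w X \<in> Hom A (s (Ob T X)) X" "Mor T (s (Ob T X)) X (w X) = u (Ob T X)"
    if "X \<in> Obj A" for X using that by (simp_all add: w_def)
  have "nat_trans A A (comp_fctr S T) id_fctr w"
  proof (intro nat_trans.intro nat_trans_axioms.intro cat_functor_comp[OF T S] A.cat_functor_id)
    fix X Y f assume "X \<in> Obj A" "Y \<in> Obj A" "f \<in> Hom A X Y"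
    then show "Comp A (Ob (comp_fctr S T) X) (Ob (comp_fctr S T) Y) (Ob id_fctr Y) (w Y) (Mor (comp_fctr S T) X Y f)
       = Comp A (Ob (comp_fctr S T) X) (Ob id_fctr X) (Ob id_fctr Y) (Mor id_fctr X Y f) (w X)"
      by (intro fully_faithful_inj[OF ff, of "s (Ob T X)" Y]) simp_all
  qed simp_all
  moreover have "is_iso A (s (Ob T X)) X (w X)" if X: "X \<in> Obj A" for X
    unfolding is_iso_def
  proof (intro conjI bexI)
    let ?z = "inv X (s (Ob T X)) (v (Ob T X))"
    show "w X \<in> Hom A (s (Ob T X)) X" "?z \<in> Hom A X (s (Ob T X))" using X by simp_all
    show "Comp A (s (Ob T X)) X (s (Ob T X)) ?z (w X) = Idn A (s (Ob T X))"
      using X by (intro fully_faithful_inj[OF ff, of "s (Ob T X)" "s (Ob T X)"]) simp_all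
    show "Comp A X (s (Ob T X)) X (w X) ?z = Idn A X"
      using X by (intro fully_faithful_inj[OF ff, of X X]) simp_all
  qed
  ultimately have "naturally_isomorphic A A (comp_fctr S T) id_fctr"
    unfolding naturally_isomorphic_def by (auto intro!: exI[of _ w])
  with TS S T show ?thesis unfolding equivalence_def by blast
qed

section \<open>Idempotent completion of categories and functors\<close>

lemma Obj_idem_completion [simp]:
  "(X, p) \<in> Obj (idem_completion A) \<longleftrightarrow> X \<in> Obj A \<and> p \<in> Hom A X X \<and> Comp A X X X p p = p"
  by (simp add: idem_completion_def)

lemma Idn_idem_completion [simp]: "Idn (idem_completion A) (X, p) = p"
  by (simp add: idem_completion_def)

lemma Comp_idem_completion [simp]:
  "Comp (idem_completion A) (X, p) (Y, q) (Z, r) = Comp A X Y Z"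
  by (simp add: idem_completion_def)

text \<open>Idempotence of \<open>p\<close> and \<open>q\<close> splits the condition
  \<open>f = q f p\<close> into absorption on each side, which is directly usable for
  rewriting.\<close>

lemma (in category) Hom_idem_completion:
  assumes "(X, p) \<in> Obj (idem_completion C)" "(Y, q) \<in> Obj (idem_completion C)"
  shows "f \<in> Hom (idem_completion C) (X, p) (Y, q) \<longleftrightarrow>
    f \<in> Hom C X Y \<and> Comp C X Y Y q f = f \<and> Comp C X X Y f p = f"
proof -
  have "Comp C X Y Y q f = f \<and> Comp C X X Y f p = f"
    if f: "f \<in> Hom C X Y" and eq: "f = Comp C X Y Y q (Comp C X X Y f p)"
  proof -
    have "Comp C X Y Y q (Comp C X Y Y q (Comp C X X Y f p)) = Comp C X Y Y q (Comp C X X Y f p)"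
      using assms f Comp_assoc[of X Y Y Y "Comp C X X Y f p" q q] by simp
    moreover have "Comp C X X Y (Comp C X Y Y q (Comp C X X Y f p)) p = Comp C X Y Y q (Comp C X X Y f p)"
      using assms f by simp
    ultimately show ?thesis using eq by simp
  qed
  then show ?thesis using assms by (auto simp: idem_completion_def)
qed

lemma (in category) category_idem_completion: "category (idem_completion C)"
proof
  fix X assume "X \<in> Obj (idem_completion C)"
  then show "Idn (idem_completion C) X \<in> Hom (idem_completion C) X X"
    by (cases X) (simp add: Hom_idem_completion)
next
  fix X Y Z f g assume *: "X \<in> Obj (idem_completion C)" "Y \<in> Obj (idem_completion C)" "Z \<in> Obj (idem_completion C)"
    "f \<in> Hom (idem_completion C) X Y" "g \<in> Hom (idem_completion C) Y Z"
  obtain X' p Y' q Z' r where "X = (X', p)" "Y = (Y', q)" "Z = (Z', r)" by (metis surj_pair)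
  with * show "Comp (idem_completion C) X Y Z g f \<in> Hom (idem_completion C) X Z"
    using Comp_assoc[of X' Y' Z' Z' f g r] by (simp add: Hom_idem_completion)
next
  fix X Y f assume *: "X \<in> Obj (idem_completion C)" "Y \<in> Obj (idem_completion C)"
    "f \<in> Hom (idem_completion C) X Y"
  obtain X' p Y' q where "X = (X', p)" "Y = (Y', q)" by (metis surj_pair)
  with * show "Comp (idem_completion C) X Y Y (Idn (idem_completion C) Y) f = f"
    "Comp (idem_completion C) X X Y f (Idn (idem_completion C) X) = f"
    by (simp_all add: Hom_idem_completion)
next
  fix W X Y Z f g h assume *: "W \<in> Obj (idem_completion C)"
    "X \<in> Obj (idem_completion C)" "Y \<in> Obj (idem_completion C)" "Z \<in> Obj (idem_completion C)"
    "f \<in> Hom (idem_completion C) W X" "g \<in> Hom (idem_completion C) X Y" "h \<in> Hom (idem_completion C) Y Z"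
  obtain W' o' X' p Y' q Z' r where "W = (W', o')" "X = (X', p)" "Y = (Y', q)" "Z = (Z', r)"
    by (metis surj_pair)
  with * show "Comp (idem_completion C) W Y Z h (Comp (idem_completion C) W X Y g f)
    = Comp (idem_completion C) W X Z (Comp (idem_completion C) X Y Z h g) f"
    by (simp add: Hom_idem_completion)
qed

lemma idem_completion_fctr_simps [simp]:
  "Ob (idem_completion_fctr T) (X, p) = (Ob T X, Mor T X X p)"
  "Mor (idem_completion_fctr T) (X, p) (Y, q) = Mor T X Y"
  by (simp_all add: idem_completion_fctr_def)

lemma (in cat_functor) cat_functor_idem_completion:
  "cat_functor (idem_completion A) (idem_completion B) (idem_completion_fctr T)"
proof (intro cat_functor.intro cat_functor_axioms.intro A.category_idem_completion B.category_idem_completion)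
  fix X assume "X \<in> Obj (idem_completion A)"
  then show "Ob (idem_completion_fctr T) X \<in> Obj (idem_completion B)"
    "Mor (idem_completion_fctr T) X X (Idn (idem_completion A) X)
      = Idn (idem_completion B) (Ob (idem_completion_fctr T) X)"
    by (cases X; simp flip: Mor_Comp)+
next
  fix X Y f assume *: "X \<in> Obj (idem_completion A)" "Y \<in> Obj (idem_completion A)"
    "f \<in> Hom (idem_completion A) X Y"
  obtain X' p Y' q where "X = (X', p)" "Y = (Y', q)" by (metis surj_pair)
  with * show "Mor (idem_completion_fctr T) X Y f
      \<in> Hom (idem_completion B) (Ob (idem_completion_fctr T) X) (Ob (idem_completion_fctr T) Y)"
    by (simp add: A.Hom_idem_completion B.Hom_idem_completion flip: Mor_Comp)
next
  fix X Y Z f g assume *: "X \<in> Obj (idem_completion A)" "Y \<in> Obj (idem_completion A)" "Z \<in> Obj (idem_completion A)"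
    "f \<in> Hom (idem_completion A) X Y" "g \<in> Hom (idem_completion A) Y Z"
  obtain X' p Y' q Z' r where "X = (X', p)" "Y = (Y', q)" "Z = (Z', r)" by (metis surj_pair)
  with * show "Mor (idem_completion_fctr T) X Z (Comp (idem_completion A) X Y Z g f)
    = Comp (idem_completion B) (Ob (idem_completion_fctr T) X) (Ob (idem_completion_fctr T) Y)
        (Ob (idem_completion_fctr T) Z) (Mor (idem_completion_fctr T) Y Z g)
        (Mor (idem_completion_fctr T) X Y f)"
    by (simp add: A.Hom_idem_completion)
qed

theorem fully_faithful_retracts_equivalence:
  assumes T: "cat_functor A B T" and ff: "fully_faithful A B T"
    and retr: "\<And>Y. Y \<in> Obj B \<Longrightarrow> \<exists>X \<in> Obj A. \<exists>i \<in> Hom B Y (Ob T X). \<exists>r \<in> Hom B (Ob T X) Y.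
      Comp B Y (Ob T X) Y r i = Idn B Y"
  shows "equivalence_up_to_retracts A B T"
proof -
  interpret cat_functor A B T by (rule T)
  let ?A = "idem_completion A" and ?B = "idem_completion B" and ?T = "idem_completion_fctr T"
  interpret T: cat_functor ?A ?B ?T by (rule cat_functor_idem_completion)
  have "fully_faithful ?A ?B ?T"
  proof (rule fully_faithfulI[OF cat_functor_idem_completion])
    fix X Y f g assume *: "X \<in> Obj ?A" "Y \<in> Obj ?A" "f \<in> Hom ?A X Y" "g \<in> Hom ?A X Y"
      "Mor ?T X Y f = Mor ?T X Y g"
    obtain X' p Y' q where "X = (X', p)" "Y = (Y', q)" by (metis surj_pair)
    with * show "f = g"
      by (intro fully_faithful_inj[OF ff, of X' Y']) (simp_all add: A.Hom_idem_completion)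
  next
    fix X Y h assume *: "X \<in> Obj ?A" "Y \<in> Obj ?A" "h \<in> Hom ?B (Ob ?T X) (Ob ?T Y)"
    obtain X' p Y' q where XY: "X = (X', p)" "Y = (Y', q)" by (metis surj_pair)
    have TX: "(Ob T X', Mor T X' X' p) \<in> Obj ?B" "(Ob T Y', Mor T Y' Y' q) \<in> Obj ?B"
      using T.Ob_in_Obj * XY by force+
    have h: "h \<in> Hom B (Ob T X') (Ob T Y')"
      "Comp B (Ob T X') (Ob T Y') (Ob T Y') (Mor T Y' Y' q) h = h"
      "Comp B (Ob T X') (Ob T X') (Ob T Y') h (Mor T X' X' p) = h"
      using * B.Hom_idem_completion[OF TX] by (simp_all add: XY)
    obtain f where f: "f \<in> Hom A X' Y'" "Mor T X' Y' f = h"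
      using fully_faithful_surj[OF ff _ _ h(1)] * XY by auto
    \<comment> \<open>\<open>h\<close> absorbs the images of \<open>p\<close> and \<open>q\<close>;
      faithfulness of \<open>T\<close> transfers this to the lift \<open>f\<close>.\<close>
    have "Comp A X' Y' Y' q f = f" "Comp A X' X' Y' f p = f"
      using * XY f h by (auto intro!: fully_faithful_inj[OF ff, of X' Y'])
    then have "f \<in> Hom ?A X Y" using * f XY by (simp add: A.Hom_idem_completion)
    with f XY show "\<exists>f \<in> Hom ?A X Y. Mor ?T X Y f = h" by auto
  qed
  moreover have "\<exists>X \<in> Obj ?A. \<exists>f. is_iso ?B (Ob ?T X) Y f" if "Y \<in> Obj ?B" for Y
  proof -
    obtain Z q where Y: "Y = (Z, q)" by (metis surj_pair)
    with that have q: "Z \<in> Obj B" "q \<in> Hom B Z Z" "Comp B Z Z Z q q = q" by simp_all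
    then obtain X i r where X: "X \<in> Obj A" and i: "i \<in> Hom B Z (Ob T X)"
      and r: "r \<in> Hom B (Ob T X) Z" and ri: "Comp B Z (Ob T X) Z r i = Idn B Z"
      using retr by metis
    \<comment> \<open>The idempotent \<open>q\<close> transported to \<open>T X\<close> along the
      splitting. Because \<open>r i\<close> is the identity, \<open>q r\<close> and
      \<open>i q\<close> are mutually inverse between \<open>(T X, m)\<close> and
      \<open>(Z, q)\<close>.\<close>
    define m where "m = Comp B (Ob T X) Z (Ob T X) i (Comp B (Ob T X) Z Z q r)"
    note [simp] = q X i r ri B.Comp_cancel[OF ri]
    have qq [simp]: "Comp B W Z Z q (Comp B W Z Z q f) = Comp B W Z Z q f"
      if "W \<in> Obj B" "f \<in> Hom B W Z" for W f
      using that B.Comp_assoc[of W Z Z Z f q q] by simp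
    have "m \<in> Hom B (Ob T X) (Ob T X)" by (simp add: m_def)
    then obtain p where p: "p \<in> Hom A X X" "Mor T X X p = m"
      using fully_faithful_surj[OF ff X X] by metis
    have mm: "Comp B (Ob T X) (Ob T X) (Ob T X) m m = m" by (simp add: m_def)
    have pp: "Comp A X X X p p = p"
      using p mm by (intro fully_faithful_inj[OF ff, of X X]) simp_all
    have obj: "(Ob T X, m) \<in> Obj ?B" "(Z, q) \<in> Obj ?B" using mm by (simp_all add: m_def)
    have "is_iso ?B (Ob T X, m) (Z, q) (Comp B (Ob T X) Z Z q r)"
      unfolding is_iso_def B.Hom_idem_completion[OF obj]
      by (intro conjI bexI[of _ "Comp B Z Z (Ob T X) i q"])
        (simp_all add: B.Hom_idem_completion[OF obj(2,1)], simp_all add: m_def)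
    then have "is_iso ?B (Ob ?T (X, p)) Y (Comp B (Ob T X) Z Z q r)" by (simp add: p Y)
    then show ?thesis using p pp X by (intro bexI[of _ "(X, p)"]) auto
  qed
  ultimately have "equivalence ?A ?B ?T"
    by (intro fully_faithful_ess_surj_equivalence cat_functor_idem_completion)
  then show ?thesis by (simp add: equivalence_up_to_retracts_def T)
qed


section \<open>The coidentifier\<close>

locale identity_endo = category D + e: nat_trans D D id_fctr id_fctr e
  for D :: "('p, 'n) cat" and e :: "'p \<Rightarrow> 'n"
begin

lemma e_in_Hom [simp]: "X \<in> Obj D \<Longrightarrow> e X \<in> Hom D X X"
  using e.component_in_Hom by simp

lemma e_natural:
  "\<lbrakk>X \<in> Obj D; Y \<in> Obj D; f \<in> Hom D X Y\<rbrakk> \<Longrightarrow> Comp D X Y Y (e Y) f = Comp D X X Y f (e X)"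
  using e.naturality by simp

abbreviation cls :: "'p \<Rightarrow> 'p \<Rightarrow> 'n \<Rightarrow> 'n set" where
  "cls X Y f \<equiv> coidentifier_rel D e X Y `` {f}"

lemma cls_eq_iff:
  "\<lbrakk>f \<in> Hom D X Y; g \<in> Hom D X Y\<rbrakk> \<Longrightarrow>
    cls X Y f = cls X Y g \<longleftrightarrow> Comp D X Y Y (e Y) f = Comp D X Y Y (e Y) g"
  by (auto simp: coidentifier_rel_def)

lemma mem_cls:
  "f \<in> Hom D X Y \<Longrightarrow>
    g \<in> cls X Y f \<longleftrightarrow> g \<in> Hom D X Y \<and> Comp D X Y Y (e Y) g = Comp D X Y Y (e Y) f"
  by (auto simp: coidentifier_rel_def)

lemma Obj_coidentifier [simp]: "Obj (coidentifier D e) = Obj D"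
  by (simp add: coidentifier_def quotient_cat_def)

lemma Hom_coidentifier: "Hom (coidentifier D e) X Y = cls X Y ` Hom D X Y"
  by (auto simp: coidentifier_def quotient_cat_def quotient_def)

lemma cls_in_Hom [simp]: "f \<in> Hom D X Y \<Longrightarrow> cls X Y f \<in> Hom (coidentifier D e) X Y"
  by (simp add: Hom_coidentifier)

lemma Idn_coidentifier [simp]: "Idn (coidentifier D e) X = cls X X (Idn D X)"
  by (simp add: coidentifier_def quotient_cat_def)

text \<open>Composition of classes is a union over all representatives, so the class of the
  composite must not depend on them. Naturality of \<open>e\<close> gives this: e g' f' = e g f' = g
  e f' = g e f = e g f.\<close>

lemma Comp_coidentifier [simp]:
  assumes [simp]: "X \<in> Obj D" "Y \<in> Obj D" "Z \<in> Obj D" "f \<in> Hom D X Y" "g \<in> Hom D Y Z"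
  shows "Comp (coidentifier D e) X Y Z (cls Y Z g) (cls X Y f) = cls X Z (Comp D X Y Z g f)"
proof -
  have "cls X Z (Comp D X Y Z g' f') = cls X Z (Comp D X Y Z g f)"
    if f': "f' \<in> cls X Y f" and g': "g' \<in> cls Y Z g" for f' g'
  proof -
    have [simp]: "f' \<in> Hom D X Y" "g' \<in> Hom D Y Z"
      using assms f' g' mem_cls by blast+
    have eqs: "Comp D X Y Y (e Y) f' = Comp D X Y Y (e Y) f"
      "Comp D Y Z Z (e Z) g' = Comp D Y Z Z (e Z) g"
      using assms f' g' mem_cls by blast+
    have "Comp D X Z Z (e Z) (Comp D X Y Z g' f') = Comp D X Z Z (e Z) (Comp D X Y Z g f')"
      using Comp_square[OF eqs(2)] by simp
    also have "\<dots> = Comp D X Y Z g (Comp D X Y Y (e Y) f')"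
      using Comp_square[OF e_natural[of Y Z g]] by simp
    also have "\<dots> = Comp D X Z Z (e Z) (Comp D X Y Z g f)"
      using Comp_square[OF e_natural[of Y Z g]] by (simp add: eqs)
    finally show ?thesis by (simp add: cls_eq_iff)
  qed
  then have "Comp (coidentifier D e) X Y Z (cls Y Z g) (cls X Y f)
      = (\<Union>g'\<in>cls Y Z g. \<Union>f'\<in>cls X Y f. cls X Z (Comp D X Y Z g f))"
    unfolding coidentifier_def quotient_cat_def cat.simps by (intro SUP_cong refl)
  \<comment> \<open>A constant union collapses to its value only over nonempty index sets.\<close>
  moreover have "cls X Y f \<noteq> {}" "cls Y Z g \<noteq> {}"
    using assms mem_cls by blast+
  ultimately show ?thesis by (simp only: UN_constant if_False)
qed

lemma category_coidentifier: "category (coidentifier D e)"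
  by unfold_locales (auto simp: Hom_coidentifier)

lemma coidentifier_fctr_simps [simp]:
  "Ob (coidentifier_fctr D e) X = X"
  "Mor (coidentifier_fctr D e) X Y f = cls X Y f"
  by (simp_all add: coidentifier_fctr_def quotient_fctr_def)

lemma cat_functor_coidentifier: "cat_functor D (coidentifier D e) (coidentifier_fctr D e)"
  by (intro cat_functor.intro cat_functor_axioms.intro category_axioms category_coidentifier) simp_all

end


section \<open>The Eilenberg-Moore and Kleisli categories of an adjunction\<close>

context adjunction
begin

abbreviation Free where "Free \<equiv> GF_Free C F G \<eta> \<epsilon>"
abbreviation Mod where "Mod \<equiv> GF_Mod C F G \<eta> \<epsilon>"

lemma unit_in_Hom [simp]: "X \<in> Obj C \<Longrightarrow> \<eta> X \<in> Hom C X (Ob G (Ob F X))"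
  using unit.component_in_Hom by simp

lemma counit_in_Hom [simp]: "Y \<in> Obj D \<Longrightarrow> \<epsilon> Y \<in> Hom D (Ob F (Ob G Y)) Y"
  using counit.component_in_Hom by simp

lemma unit_natural:
  "\<lbrakk>X \<in> Obj C; Y \<in> Obj C; f \<in> Hom C X Y\<rbrakk> \<Longrightarrow>
    Comp C X (Ob G (Ob F X)) (Ob G (Ob F Y)) (Mor G (Ob F X) (Ob F Y) (Mor F X Y f)) (\<eta> X)
    = Comp C X Y (Ob G (Ob F Y)) (\<eta> Y) f"
  using unit.naturality by simp

lemma counit_natural:
  "\<lbrakk>X \<in> Obj D; Y \<in> Obj D; f \<in> Hom D X Y\<rbrakk> \<Longrightarrow>
    Comp D (Ob F (Ob G X)) (Ob F (Ob G Y)) Y (\<epsilon> Y) (Mor F (Ob G X) (Ob G Y) (Mor G X Y f))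
    = Comp D (Ob F (Ob G X)) X Y f (\<epsilon> X)"
  using counit.naturality by simp

text \<open>Simplification distributes \<open>Mor G\<close> over composites, so equations of
  \<open>D\<close> no longer match below \<open>G\<close>. Their images in \<open>C\<close> are
  therefore recorded as separate rules, here and in \<open>G_triangle_F\<close>.\<close>

lemma G_counit_natural:
  "\<lbrakk>X \<in> Obj D; Y \<in> Obj D; f \<in> Hom D X Y\<rbrakk> \<Longrightarrow>
    Comp C (Ob G (Ob F (Ob G X))) (Ob G (Ob F (Ob G Y))) (Ob G Y) (Mor G (Ob F (Ob G Y)) Y (\<epsilon> Y))
      (Mor G (Ob F (Ob G X)) (Ob F (Ob G Y)) (Mor F (Ob G X) (Ob G Y) (Mor G X Y f)))
    = Comp C (Ob G (Ob F (Ob G X))) (Ob G X) (Ob G Y) (Mor G X Y f) (Mor G (Ob F (Ob G X)) X (\<epsilon> X))"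
  using arg_cong[OF counit_natural[of X Y f], of "Mor G (Ob F (Ob G X)) Y"] by simp

lemma G_triangle_F:
  "X \<in> Obj C \<Longrightarrow>
    Comp C (Ob G (Ob F X)) (Ob G (Ob F (Ob G (Ob F X)))) (Ob G (Ob F X))
      (Mor G (Ob F (Ob G (Ob F X))) (Ob F X) (\<epsilon> (Ob F X)))
      (Mor G (Ob F X) (Ob F (Ob G (Ob F X))) (Mor F X (Ob G (Ob F X)) (\<eta> X))) = Idn C (Ob G (Ob F X))"
  using arg_cong[OF triangle_F[of X], of "Mor G (Ob F X) (Ob F X)"] by simp

text \<open>
  Used as rewrite rules, these move units to the left and counits to the right until they cancel.
\<close>

lemmas adj_simps =
  unit_natural F.A.Comp_square[OF unit_natural]
  counit_natural F.B.Comp_square[OF counit_natural]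
  G_counit_natural F.A.Comp_square[OF G_counit_natural]
  triangle_F F.B.Comp_cancel[OF triangle_F]
  triangle_G F.A.Comp_cancel[OF triangle_G]
  G_triangle_F F.A.Comp_cancel[OF G_triangle_F]

section \<open>The Kleisli category and the category of modules\<close>

lemma Free_simps [simp]:
  "Obj Free = Obj C"
  "Hom Free X Y = Hom C X (Ob G (Ob F Y))"
  "Idn Free X = \<eta> X"
  "Comp Free X Y Z g f =
     Comp C X (Ob G (Ob F (Ob G (Ob F Z)))) (Ob G (Ob F Z))
       (Mor G (Ob F (Ob G (Ob F Z))) (Ob F Z) (\<epsilon> (Ob F Z)))
       (Comp C X (Ob G (Ob F Y)) (Ob G (Ob F (Ob G (Ob F Z))))
         (Mor G (Ob F Y) (Ob F (Ob G (Ob F Z))) (Mor F Y (Ob G (Ob F Z)) g)) f)"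
  by (simp_all add: GF_Free_def Kleisli_def adj_mult_def)

lemma category_Free: "category Free"
  by unfold_locales (simp_all add: adj_simps)

lemma Obj_Mod:
  "(X, a) \<in> Obj Mod \<longleftrightarrow> X \<in> Obj C \<and> a \<in> Hom C (Ob G (Ob F X)) X \<and>
     Comp C (Ob G (Ob F (Ob G (Ob F X)))) (Ob G (Ob F X)) X a
       (Mor G (Ob F (Ob G (Ob F X))) (Ob F X) (Mor F (Ob G (Ob F X)) X a))
     = Comp C (Ob G (Ob F (Ob G (Ob F X)))) (Ob G (Ob F X)) X a
         (Mor G (Ob F (Ob G (Ob F X))) (Ob F X) (\<epsilon> (Ob F X))) \<and>
     Comp C X (Ob G (Ob F X)) X a (\<eta> X) = Idn C X"
  by (simp add: GF_Mod_def Eilenberg_Moore_def adj_mult_def)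

lemma Hom_Mod:
  "f \<in> Hom Mod (X, a) (Y, b) \<longleftrightarrow> f \<in> Hom C X Y \<and>
     Comp C (Ob G (Ob F X)) X Y f a
     = Comp C (Ob G (Ob F X)) (Ob G (Ob F Y)) Y b (Mor G (Ob F X) (Ob F Y) (Mor F X Y f))"
  by (simp add: GF_Mod_def Eilenberg_Moore_def)

lemma Idn_Mod [simp]: "Idn Mod (X, a) = Idn C X"
  by (simp add: GF_Mod_def Eilenberg_Moore_def)

lemma Comp_Mod [simp]: "Comp Mod (X, a) (Y, b) (Z, c) = Comp C X Y Z"
  by (simp add: GF_Mod_def Eilenberg_Moore_def)

lemma category_Mod: "category Mod"
proof
  fix X assume "X \<in> Obj Mod"
  then show "Idn Mod X \<in> Hom Mod X X"
    by (cases X) (simp add: Hom_Mod Obj_Mod)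
next
  fix X Y Z f g assume *: "X \<in> Obj Mod" "Y \<in> Obj Mod" "Z \<in> Obj Mod" "f \<in> Hom Mod X Y" "g \<in> Hom Mod Y Z"
  obtain X' a Y' b Z' c where XYZ: "X = (X', a)" "Y = (Y', b)" "Z = (Z', c)" by (metis surj_pair)
  with * have [simp]: "X' \<in> Obj C" "Y' \<in> Obj C" "Z' \<in> Obj C" "f \<in> Hom C X' Y'" "g \<in> Hom C Y' Z'"
    "a \<in> Hom C (Ob G (Ob F X')) X'" "b \<in> Hom C (Ob G (Ob F Y')) Y'" "c \<in> Hom C (Ob G (Ob F Z')) Z'"
    by (simp_all add: Obj_Mod Hom_Mod)
  have f: "Comp C (Ob G (Ob F X')) X' Y' f a
     = Comp C (Ob G (Ob F X')) (Ob G (Ob F Y')) Y' b (Mor G (Ob F X') (Ob F Y') (Mor F X' Y' f))"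
    and g: "Comp C (Ob G (Ob F Y')) Y' Z' g b
     = Comp C (Ob G (Ob F Y')) (Ob G (Ob F Z')) Z' c (Mor G (Ob F Y') (Ob F Z') (Mor F Y' Z' g))"
    using * by (simp_all add: XYZ Hom_Mod)
  show "Comp Mod X Y Z g f \<in> Hom Mod X Z"
    by (simp add: XYZ Hom_Mod f F.A.Comp_square[OF g])
next
  fix X Y f assume *: "X \<in> Obj Mod" "Y \<in> Obj Mod" "f \<in> Hom Mod X Y"
  obtain X' a Y' b where "X = (X', a)" "Y = (Y', b)" by (metis surj_pair)
  with * show "Comp Mod X Y Y (Idn Mod Y) f = f" "Comp Mod X X Y f (Idn Mod X) = f"
    by (simp_all add: Hom_Mod Obj_Mod)
next
  fix W X Y Z f g h assume *: "W \<in> Obj Mod" "X \<in> Obj Mod" "Y \<in> Obj Mod" "Z \<in> Obj Mod"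
    "f \<in> Hom Mod W X" "g \<in> Hom Mod X Y" "h \<in> Hom Mod Y Z"
  obtain W' o' X' a Y' b Z' c where "W = (W', o')" "X = (X', a)" "Y = (Y', b)" "Z = (Z', c)"
    by (metis surj_pair)
  with * show "Comp Mod W Y Z h (Comp Mod W X Y g f) = Comp Mod W X Z (Comp Mod X Y Z h g) f"
    by (simp add: Hom_Mod Obj_Mod)
qed

lemma comparison_K_simps [simp]:
  "Ob (comparison_K F G \<epsilon>) Y = (Ob G Y, Mor G (Ob F (Ob G Y)) Y (\<epsilon> Y))"
  "Mor (comparison_K F G \<epsilon>) = Mor G"
  by (simp_all add: comparison_K_def)

lemma cat_functor_K: "cat_functor D Mod (comparison_K F G \<epsilon>)"
  by (intro cat_functor.intro cat_functor_axioms.intro category_Mod F.B.category_axioms)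
    (simp_all add: Obj_Mod Hom_Mod adj_simps)

lemma comparison_L_simps [simp]:
  "Ob (comparison_L D F G \<epsilon>) = Ob F"
  "Mor (comparison_L D F G \<epsilon>) X Y f =
     Comp D (Ob F X) (Ob F (Ob G (Ob F Y))) (Ob F Y) (\<epsilon> (Ob F Y)) (Mor F X (Ob G (Ob F Y)) f)"
  by (simp_all add: comparison_L_def)

lemma cat_functor_L: "cat_functor Free D (comparison_L D F G \<epsilon>)"
  by (intro cat_functor.intro cat_functor_axioms.intro category_Free F.B.category_axioms)
    (simp_all add: adj_simps)

text \<open>The universal property of free modules: a linear map out of \<open>G F X\<close> is
  determined by its restriction along \<open>\<eta> X\<close>, and this restriction inverts the
  action of the functor on morphisms.\<close>

lemma fully_faithful_KL:
  "fully_faithful Free Mod (comp_fctr (comparison_K F G \<epsilon>) (comparison_L D F G \<epsilon>))"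
  (is "fully_faithful _ _ ?T")
proof (rule fully_faithfulI[OF cat_functor_comp[OF cat_functor_L cat_functor_K]])
  fix X Y f g
  assume *: "X \<in> Obj Free" "Y \<in> Obj Free" "f \<in> Hom Free X Y" "g \<in> Hom Free X Y"
    and eq: "Mor ?T X Y f = Mor ?T X Y g"
  have "Comp C X (Ob G (Ob F X)) (Ob G (Ob F Y)) (Mor ?T X Y h) (\<eta> X) = h" if "h \<in> Hom Free X Y" for h
    using * that by (simp add: adj_simps)
  then show "f = g" using * eq by metis
next
  fix X Y h assume *: "X \<in> Obj Free" "Y \<in> Obj Free" "h \<in> Hom Mod (Ob ?T X) (Ob ?T Y)"
  then have h: "h \<in> Hom C (Ob G (Ob F X)) (Ob G (Ob F Y))" and [simp]: "X \<in> Obj C" "Y \<in> Obj C"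
    and sq: "Comp C (Ob G (Ob F (Ob G (Ob F X)))) (Ob G (Ob F (Ob G (Ob F Y)))) (Ob G (Ob F Y)) (Mor G (Ob F (Ob G (Ob F Y))) (Ob F Y) (\<epsilon> (Ob F Y)))
        (Mor G (Ob F (Ob G (Ob F X))) (Ob F (Ob G (Ob F Y))) (Mor F (Ob G (Ob F X)) (Ob G (Ob F Y)) h))
     = Comp C (Ob G (Ob F (Ob G (Ob F X)))) (Ob G (Ob F X)) (Ob G (Ob F Y)) h
        (Mor G (Ob F (Ob G (Ob F X))) (Ob F X) (\<epsilon> (Ob F X)))"
    by (simp_all add: Hom_Mod)
  show "\<exists>f \<in> Hom Free X Y. Mor ?T X Y f = h"
    \<comment> \<open>Linearity \<open>sq\<close> moves \<open>h\<close> outside the multiplication,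
      which then cancels against the unit by the triangle identity for \<open>F\<close>.\<close>
    using h F.A.Comp_square[OF sq]
    by (intro bexI[of _ "Comp C X (Ob G (Ob F X)) (Ob G (Ob F Y)) h (\<eta> X)"]) (simp_all add: adj_simps)
qed

end


section \<open>Semiseparable right adjoints\<close>

locale semiseparable_adjunction = adjunction +
  fixes P :: "'c \<Rightarrow> 'c \<Rightarrow> 'b \<Rightarrow> 'd" and e :: "'c \<Rightarrow> 'd"
  assumes witness: "semiseparability_witness D C G P"
    and e_def: "X \<in> Obj D \<Longrightarrow> e X = P X X (Idn C (Ob G X))"
begin

section \<open>The natural transformation \<open>P\<close> and its idempotent\<close>

lemma P_in_Hom [simp]:
  "\<lbrakk>X \<in> Obj D; Y \<in> Obj D; h \<in> Hom C (Ob G X) (Ob G Y)\<rbrakk> \<Longrightarrow> P X Y h \<in> Hom D X Y"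
  using witness by (simp add: semiseparability_witness_def hom_nat_trans_def)

lemma GPG: "\<lbrakk>X \<in> Obj D; Y \<in> Obj D; f \<in> Hom D X Y\<rbrakk> \<Longrightarrow> Mor G X Y (P X Y (Mor G X Y f)) = Mor G X Y f"
  using witness by (simp add: semiseparability_witness_def)

lemma P_natural:
  assumes "X \<in> Obj D" "Y \<in> Obj D" "X' \<in> Obj D" "Y' \<in> Obj D"
    "f \<in> Hom D X' X" "g \<in> Hom D Y Y'" "h \<in> Hom C (Ob G X) (Ob G Y)"
  shows "P X' Y' (Comp C (Ob G X') (Ob G Y) (Ob G Y') (Mor G Y Y' g)
           (Comp C (Ob G X') (Ob G X) (Ob G Y) h (Mor G X' X f)))
         = Comp D X' Y Y' g (Comp D X' X Y (P X Y h) f)"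
  using witness assms by (simp add: semiseparability_witness_def hom_nat_trans_def)

lemma P_Comp_left:
  assumes "X \<in> Obj D" "Y \<in> Obj D" "Y' \<in> Obj D" "g \<in> Hom D Y Y'" "h \<in> Hom C (Ob G X) (Ob G Y)"
  shows "P X Y' (Comp C (Ob G X) (Ob G Y) (Ob G Y') (Mor G Y Y' g) h) = Comp D X Y Y' g (P X Y h)"
  using P_natural[of X Y X Y' "Idn D X" g h] assms by simp

lemma P_Comp_right:
  assumes "X \<in> Obj D" "Y \<in> Obj D" "X' \<in> Obj D" "f \<in> Hom D X' X" "h \<in> Hom C (Ob G X) (Ob G Y)"
  shows "P X' Y (Comp C (Ob G X') (Ob G X) (Ob G Y) h (Mor G X' X f)) = Comp D X' X Y (P X Y h) f"
  using P_natural[of X Y X' Y f "Idn D Y" h] assms by simp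

text \<open>\<open>f\<close> is pulled out of \<open>P\<close> on the right, and in
  \<open>Comp_e\<close> on the left. Both composites thus equal P (G f), which is the naturality of
  \<open>e\<close>.\<close>

lemma e_Comp: "\<lbrakk>X \<in> Obj D; Y \<in> Obj D; f \<in> Hom D X Y\<rbrakk> \<Longrightarrow> Comp D X Y Y (e Y) f = P X Y (Mor G X Y f)"
  using P_Comp_right[of Y Y X f "Idn C (Ob G Y)"] by (simp add: e_def)

lemma Comp_e: "\<lbrakk>X \<in> Obj D; Y \<in> Obj D; f \<in> Hom D X Y\<rbrakk> \<Longrightarrow> Comp D X X Y f (e X) = P X Y (Mor G X Y f)"
  using P_Comp_left[of X X Y f "Idn C (Ob G X)"] by (simp add: e_def)

lemma e_Hom [simp]: "X \<in> Obj D \<Longrightarrow> e X \<in> Hom D X X"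
  by (simp add: e_def)

lemma G_e [simp]: "X \<in> Obj D \<Longrightarrow> Mor G X X (e X) = Idn C (Ob G X)"
  using GPG[of X X "Idn D X"] by (simp add: e_def)

sublocale coid: identity_endo D e
  by unfold_locales (simp_all add: e_Comp Comp_e)

text \<open>The composite e f = P (G f) depends only on \<open>G f\<close>, and \<open>G\<close>
  recovers \<open>G f\<close> from it by G P G = G.\<close>

lemma cls_eq_iff_G:
  assumes "X \<in> Obj D" "Y \<in> Obj D" "f \<in> Hom D X Y" "g \<in> Hom D X Y"
  shows "coid.cls X Y f = coid.cls X Y g \<longleftrightarrow> Mor G X Y f = Mor G X Y g"
  using assms GPG by (metis coid.cls_eq_iff e_Comp)

text \<open>A lift of the unit to \<open>D\<close>. In general \<open>\<eta> (G Y)\<close> is not in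
  the image of \<open>G\<close>, so \<open>G (\<chi> Y)\<close> may differ from it.\<close>

definition \<chi> :: "'c \<Rightarrow> 'd" where
  "\<chi> Y = P Y (Ob F (Ob G Y)) (\<eta> (Ob G Y))"

lemma \<chi>_in_Hom [simp]: "Y \<in> Obj D \<Longrightarrow> \<chi> Y \<in> Hom D Y (Ob F (Ob G Y))"
  by (simp add: \<chi>_def)

text \<open>In the naturality square of \<open>\<eta>\<close> at \<open>G f\<close>, the sides other
  than the units are images under \<open>G\<close>, so they can be pulled out of
  \<open>P\<close>.\<close>

lemma \<chi>_natural:
  assumes "X \<in> Obj D" "Y \<in> Obj D" "f \<in> Hom D X Y"
  shows "Comp D X Y (Ob F (Ob G Y)) (\<chi> Y) f
    = Comp D X (Ob F (Ob G X)) (Ob F (Ob G Y)) (Mor F (Ob G X) (Ob G Y) (Mor G X Y f)) (\<chi> X)"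
  using assms unit_natural[of "Ob G X" "Ob G Y" "Mor G X Y f"]
  by (simp add: \<chi>_def flip: P_Comp_left P_Comp_right)

lemma G_\<chi>_natural:
  assumes "X \<in> Obj D" "Y \<in> Obj D" "f \<in> Hom D X Y"
  shows "Comp C (Ob G X) (Ob G Y) (Ob G (Ob F (Ob G Y))) (Mor G Y (Ob F (Ob G Y)) (\<chi> Y)) (Mor G X Y f)
    = Comp C (Ob G X) (Ob G (Ob F (Ob G X))) (Ob G (Ob F (Ob G Y)))
        (Mor G (Ob F (Ob G X)) (Ob F (Ob G Y)) (Mor F (Ob G X) (Ob G Y) (Mor G X Y f)))
        (Mor G X (Ob F (Ob G X)) (\<chi> X))"
  using arg_cong[OF \<chi>_natural[OF assms], of "Mor G X (Ob F (Ob G Y))"] assms by simp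

text \<open>Pulling the counit into \<open>P\<close> leaves G \<epsilon> after \<eta>, an identity
  by the triangle identity, and \<open>P\<close> sends that identity to \<open>e Y\<close>.\<close>

lemma counit_\<chi>:
  assumes "Y \<in> Obj D"
  shows "Comp D Y (Ob F (Ob G Y)) Y (\<epsilon> Y) (\<chi> Y) = e Y"
  using assms by (simp add: \<chi>_def e_def triangle_G flip: P_Comp_left)

lemma G_counit_\<chi>:
  assumes "Y \<in> Obj D"
  shows "Comp C (Ob G Y) (Ob G (Ob F (Ob G Y))) (Ob G Y) (Mor G (Ob F (Ob G Y)) Y (\<epsilon> Y))
    (Mor G Y (Ob F (Ob G Y)) (\<chi> Y)) = Idn C (Ob G Y)"
  using arg_cong[OF counit_\<chi>[OF assms], of "Mor G Y Y"] assms by simp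

text \<open>
  Via \<open>G \<chi>\<close> the multiplication of the monad has a bilinear section, so that every module is a
  retract of the free module on its underlying object.
\<close>

lemma module_retract_of_free:
  assumes "(X, a) \<in> Obj Mod"
  shows "\<exists>s \<in> Hom Mod (X, a) (Ob (comparison_K F G \<epsilon>) (Ob F X)).
    \<exists>r \<in> Hom Mod (Ob (comparison_K F G \<epsilon>) (Ob F X)) (X, a).
      Comp Mod (X, a) (Ob (comparison_K F G \<epsilon>) (Ob F X)) (X, a) r s = Idn Mod (X, a)"
proof -
  let ?GF = "\<lambda>X. Ob G (Ob F X)"
  let ?GFa = "Mor G (Ob F (?GF X)) (Ob F X) (Mor F (?GF X) X a)"
  let ?m = "Mor G (Ob F (?GF X)) (Ob F X) (\<epsilon> (Ob F X))"
  let ?\<chi> = "Mor G (Ob F X) (Ob F (?GF X)) (\<chi> (Ob F X))"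
  have [simp]: "X \<in> Obj C" "a \<in> Hom C (?GF X) X"
    and act: "Comp C (?GF (?GF X)) (?GF X) X a ?GFa = Comp C (?GF (?GF X)) (?GF X) X a ?m"
    and one: "Comp C X (?GF X) X a (\<eta> X) = Idn C X"
    using assms by (simp_all add: Obj_Mod)
  \<comment> \<open>\<open>?\<chi>\<close> is a section of the multiplication \<open>?m\<close>.
    Followed by \<open>?GFa\<close> it yields \<open>t\<close>, and restricting \<open>t\<close>
    along the unit gives the candidate section \<open>s\<close> of \<open>a\<close>.\<close>
  define t where "t = Comp C (?GF X) (?GF (?GF X)) (?GF X) ?GFa ?\<chi>"
  define s where "s = Comp C X (?GF X) (?GF X) t (\<eta> X)"
  have [simp]: "t \<in> Hom C (?GF X) (?GF X)" "s \<in> Hom C X (?GF X)" by (simp_all add: t_def s_def)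
  have "Comp C X (?GF X) X a s = Idn C X"
    by (simp add: s_def t_def F.A.Comp_square[OF act] F.A.Comp_cancel[OF G_counit_\<chi>] one)
  moreover have sa: "Comp C (?GF X) X (?GF X) s a = t"
  proof -
    \<comment> \<open>The associativity law \<open>act\<close> under \<open>G F\<close>, needed on
      the far side of \<open>?\<chi>\<close>.\<close>
    have "Comp C (?GF (?GF (?GF X))) (?GF (?GF X)) (?GF X) ?GFa
        (Mor G (Ob F (?GF (?GF X))) (Ob F (?GF X)) (Mor F (?GF (?GF X)) (?GF X) ?GFa))
      = Comp C (?GF (?GF (?GF X))) (?GF (?GF X)) (?GF X) ?GFa
        (Mor G (Ob F (?GF (?GF X))) (Ob F (?GF X)) (Mor F (?GF (?GF X)) (?GF X) ?m))"
      using arg_cong[OF act, of "\<lambda>h. Mor G (Ob F (?GF (?GF X))) (Ob F X) (Mor F (?GF (?GF X)) X h)"]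
      by simp
    note act' = F.A.Comp_square[OF this]
    have "Comp C (?GF X) X (?GF X) s a
      = Comp C (?GF X) (?GF (?GF X)) (?GF X) ?GFa (Comp C (?GF X) (?GF X) (?GF (?GF X)) ?\<chi>
          (Comp C (?GF X) (?GF (?GF X)) (?GF X) ?GFa (\<eta> (?GF X))))"
      by (simp add: s_def t_def unit_natural)
    \<comment> \<open>\<chi> is natural along both \<open>F a\<close> and the counit at
      \<open>F X\<close>. Moving each across \<chi> turns the two sides into those of
      \<open>act'\<close>, so the inner \<open>?GFa\<close> may be replaced by
      \<open>?m\<close>.\<close>
    also have "\<dots> = Comp C (?GF X) (?GF (?GF X)) (?GF X) ?GFa (Comp C (?GF X) (?GF X) (?GF (?GF X)) ?\<chi>
          (Comp C (?GF X) (?GF (?GF X)) (?GF X) ?m (\<eta> (?GF X))))"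
      by (simp add: act' F.A.Comp_square[OF G_\<chi>_natural])
    also have "\<dots> = t" by (simp add: triangle_G t_def)
    finally show ?thesis .
  qed
  \<comment> \<open>Together with \<open>sa\<close> this is linearity of \<open>s\<close>; linearity
    of the retraction \<open>a\<close> is \<open>act\<close>.\<close>
  moreover have "Comp C (?GF X) (?GF (?GF X)) (?GF X) ?m (Mor G (Ob F X) (Ob F (?GF X)) (Mor F X (?GF X) s)) = t"
    by (simp add: s_def t_def adj_simps)
  ultimately show ?thesis
    by (intro bexI[of _ s] bexI[of _ a]) (simp_all add: Hom_Mod act)
qed

section \<open>The two functors out of the Kleisli category\<close>

lemma KL_equivalence_up_to_retracts:
  "equivalence_up_to_retracts Free Mod (comp_fctr (comparison_K F G \<epsilon>) (comparison_L D F G \<epsilon>))"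
proof (rule fully_faithful_retracts_equivalence[OF _ fully_faithful_KL])
  fix Y assume "Y \<in> Obj Mod"
  moreover obtain X a where "Y = (X, a)" by (metis surj_pair)
  ultimately show "\<exists>X \<in> Obj Free.
      \<exists>i \<in> Hom Mod Y (Ob (comp_fctr (comparison_K F G \<epsilon>) (comparison_L D F G \<epsilon>)) X).
      \<exists>r \<in> Hom Mod (Ob (comp_fctr (comparison_K F G \<epsilon>) (comparison_L D F G \<epsilon>)) X) Y.
        Comp Mod Y (Ob (comp_fctr (comparison_K F G \<epsilon>) (comparison_L D F G \<epsilon>)) X) Y r i = Idn Mod Y"
    using module_retract_of_free[of X a] by (intro bexI[of _ X]) (simp_all add: Obj_Mod)
qed (rule cat_functor_comp[OF cat_functor_L cat_functor_K])

text \<open>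
  \<open>H\<close> need not be faithful, but it is so on morphisms between objects \<open>F X\<close> and \<open>F Y\<close>, because
  \<open>G\<close> is and \<open>H\<close> identifies exactly the morphisms identified by \<open>G\<close>.
\<close>

lemma HL_equivalence_up_to_retracts:
  "equivalence_up_to_retracts Free (coidentifier D e)
     (comp_fctr (coidentifier_fctr D e) (comparison_L D F G \<epsilon>))"
  (is "equivalence_up_to_retracts _ _ ?T")
proof -
  have T: "cat_functor Free (coidentifier D e) ?T"
    by (rule cat_functor_comp[OF cat_functor_L coid.cat_functor_coidentifier])
  interpret L: cat_functor Free D "comparison_L D F G \<epsilon>" by (rule cat_functor_L)
  show ?thesis
  proof (rule fully_faithful_retracts_equivalence[OF T fully_faithfulI[OF T]])
    fix X Y f g assume *: "X \<in> Obj Free" "Y \<in> Obj Free" "f \<in> Hom Free X Y" "g \<in> Hom Free X Y"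
      and eq: "Mor ?T X Y f = Mor ?T X Y g"
    have "Mor (comparison_L D F G \<epsilon>) X Y f \<in> Hom D (Ob F X) (Ob F Y)"
      "Mor (comparison_L D F G \<epsilon>) X Y g \<in> Hom D (Ob F X) (Ob F Y)"
      using * by simp_all
    \<comment> \<open>The action of the Kleisli comparison stays folded so that
      \<open>cls_eq_iff_G\<close> applies. Followed by \<open>G\<close> it is the action of the
      functor in \<open>fully_faithful_KL\<close>.\<close>
    with * eq cls_eq_iff_G have "Mor G (Ob F X) (Ob F Y) (Mor (comparison_L D F G \<epsilon>) X Y f)
      = Mor G (Ob F X) (Ob F Y) (Mor (comparison_L D F G \<epsilon>) X Y g)"
      by (simp del: comparison_L_simps(2) F.Mor_Comp G.Mor_Comp)
    then show "f = g"
      by (intro fully_faithful_inj[OF fully_faithful_KL *]) simp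
  next
    fix X Y h assume *: "X \<in> Obj Free" "Y \<in> Obj Free"
      "h \<in> Hom (coidentifier D e) (Ob ?T X) (Ob ?T Y)"
    then obtain k where k: "k \<in> Hom D (Ob F X) (Ob F Y)" "h = coid.cls (Ob F X) (Ob F Y) k"
      by (auto simp: coid.Hom_coidentifier)
    \<comment> \<open>The transpose of \<open>k\<close> under the adjunction; the Kleisli comparison
      sends it to \<open>k\<close> itself, already before passing to classes.\<close>
    define f where "f = Comp C X (Ob G (Ob F X)) (Ob G (Ob F Y)) (Mor G (Ob F X) (Ob F Y) k) (\<eta> X)"
    have "f \<in> Hom Free X Y" "Mor ?T X Y f = h"
      using * k by (simp_all add: f_def adj_simps)
    then show "\<exists>f \<in> Hom Free X Y. Mor ?T X Y f = h" by blast
  next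
    fix Y assume Y: "Y \<in> Obj (coidentifier D e)"
    let ?Z = "Ob F (Ob G Y)"
    \<comment> \<open>The composite is the class of \<open>e Y\<close>, which is the class of the
      identity since \<open>G\<close> sends both to an identity.\<close>
    have "Comp (coidentifier D e) Y ?Z Y (coid.cls ?Z Y (\<epsilon> Y)) (coid.cls Y ?Z (\<chi> Y)) = Idn (coidentifier D e) Y"
      using Y by (simp add: counit_\<chi> cls_eq_iff_G)
    then show "\<exists>X \<in> Obj Free. \<exists>i \<in> Hom (coidentifier D e) Y (Ob ?T X). \<exists>r \<in> Hom (coidentifier D e) (Ob ?T X) Y.
        Comp (coidentifier D e) Y (Ob ?T X) Y r i = Idn (coidentifier D e) Y"
      using Y by (intro bexI[of _ "Ob G Y"] bexI[of _ "coid.cls Y ?Z (\<chi> Y)"] bexI[of _ "coid.cls ?Z Y (\<epsilon> Y)"]) simp_all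
  qed
qed

section \<open>The factorisation of the comparison functor through the coidentifier\<close>

definition K\<^sub>e :: "('c, 'd set, 'a \<times> 'b, 'b) fctr" where
  "K\<^sub>e = \<lparr>Ob = Ob (comparison_K F G \<epsilon>), Mor = (\<lambda>X Y \<phi>. Mor G X Y (SOME f. f \<in> \<phi>))\<rparr>"

text \<open>The chosen representative does not matter: all members of a class have the same image
  under \<open>G\<close>.\<close>

lemma K\<^sub>e_simps [simp]:
  "Ob K\<^sub>e Y = (Ob G Y, Mor G (Ob F (Ob G Y)) Y (\<epsilon> Y))"
  "\<lbrakk>X \<in> Obj D; Y \<in> Obj D; f \<in> Hom D X Y\<rbrakk> \<Longrightarrow> Mor K\<^sub>e X Y (coid.cls X Y f) = Mor G X Y f"
proof -
  assume *: "X \<in> Obj D" "Y \<in> Obj D" "f \<in> Hom D X Y"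
  define g where "g = (SOME g. g \<in> coid.cls X Y f)"
  have "f \<in> coid.cls X Y f" using * coid.mem_cls by blast
  then have "g \<in> coid.cls X Y f" unfolding g_def by (rule someI)
  then have "g \<in> Hom D X Y" "coid.cls X Y g = coid.cls X Y f"
    using * coid.mem_cls coid.cls_eq_iff by blast+
  then have "Mor G X Y g = Mor G X Y f" using * cls_eq_iff_G by blast
  then show "Mor K\<^sub>e X Y (coid.cls X Y f) = Mor G X Y f"
    by (simp add: K\<^sub>e_def g_def)
qed (simp add: K\<^sub>e_def)

text \<open>Faithfulness holds because the classes are the fibres of \<open>G\<close> on each
  hom-set, fullness comes from \<chi>, and the retractions are those onto modules from the free
  modules \<open>K\<^sub>e (F X)\<close>.\<close>

lemma K\<^sub>e_equivalence_up_to_retracts: "equivalence_up_to_retracts (coidentifier D e) Mod K\<^sub>e"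
proof -
  interpret K: cat_functor D Mod "comparison_K F G \<epsilon>" by (rule cat_functor_K)
  have T: "cat_functor (coidentifier D e) Mod K\<^sub>e"
  proof (intro cat_functor.intro cat_functor_axioms.intro category_Mod coid.category_coidentifier)
    show "Ob K\<^sub>e X \<in> Obj Mod" if "X \<in> Obj (coidentifier D e)" for X
      using that K.Ob_in_Obj by simp
    show "Mor K\<^sub>e X Y f \<in> Hom Mod (Ob K\<^sub>e X) (Ob K\<^sub>e Y)"
      if "X \<in> Obj (coidentifier D e)" "Y \<in> Obj (coidentifier D e)" "f \<in> Hom (coidentifier D e) X Y" for X Y f
      using that K.Mor_in_Hom by (auto simp: coid.Hom_coidentifier)
  qed (auto simp: coid.Hom_coidentifier)
  show ?thesis
  proof (rule fully_faithful_retracts_equivalence[OF T fully_faithfulI[OF T]])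
    fix X Y \<phi> \<psi> assume *: "X \<in> Obj (coidentifier D e)" "Y \<in> Obj (coidentifier D e)"
      "\<phi> \<in> Hom (coidentifier D e) X Y" "\<psi> \<in> Hom (coidentifier D e) X Y" "Mor K\<^sub>e X Y \<phi> = Mor K\<^sub>e X Y \<psi>"
    then obtain f g where "f \<in> Hom D X Y" "\<phi> = coid.cls X Y f" "g \<in> Hom D X Y" "\<psi> = coid.cls X Y g"
      by (auto simp: coid.Hom_coidentifier)
    with * show "\<phi> = \<psi>" by (simp add: cls_eq_iff_G)
  next
    fix X Y h assume *: "X \<in> Obj (coidentifier D e)" "Y \<in> Obj (coidentifier D e)"
      "h \<in> Hom Mod (Ob K\<^sub>e X) (Ob K\<^sub>e Y)"
    then have [simp]: "X \<in> Obj D" "Y \<in> Obj D" "h \<in> Hom C (Ob G X) (Ob G Y)"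
      and sq: "Comp C (Ob G (Ob F (Ob G X))) (Ob G (Ob F (Ob G Y))) (Ob G Y) (Mor G (Ob F (Ob G Y)) Y (\<epsilon> Y))
         (Mor G (Ob F (Ob G X)) (Ob F (Ob G Y)) (Mor F (Ob G X) (Ob G Y) h))
       = Comp C (Ob G (Ob F (Ob G X))) (Ob G X) (Ob G Y) h (Mor G (Ob F (Ob G X)) X (\<epsilon> X))"
      by (simp_all add: Hom_Mod)
    \<comment> \<open>A lift of the linear map \<open>h\<close>: applying \<open>G\<close> and using
      \<open>sq\<close> gives \<open>h\<close> after G \<epsilon> after G \<chi>, and the last two
      cancel.\<close>
    define f where "f = Comp D X (Ob F (Ob G Y)) Y (\<epsilon> Y)
      (Comp D X (Ob F (Ob G X)) (Ob F (Ob G Y)) (Mor F (Ob G X) (Ob G Y) h) (\<chi> X))"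
    have "f \<in> Hom D X Y" by (simp add: f_def)
    moreover have "Mor G X Y f = h"
      by (simp add: f_def F.A.Comp_square[OF sq] G_counit_\<chi>)
    ultimately show "\<exists>\<phi> \<in> Hom (coidentifier D e) X Y. Mor K\<^sub>e X Y \<phi> = h"
      by (intro bexI[of _ "coid.cls X Y f"]) simp_all
  next
    fix Y assume Y: "Y \<in> Obj Mod"
    obtain X a where "Y = (X, a)" by (metis surj_pair)
    with Y show "\<exists>X \<in> Obj (coidentifier D e). \<exists>i \<in> Hom Mod Y (Ob K\<^sub>e X). \<exists>r \<in> Hom Mod (Ob K\<^sub>e X) Y.
        Comp Mod Y (Ob K\<^sub>e X) Y r i = Idn Mod Y"
      using module_retract_of_free[of X a] by (intro bexI[of _ "Ob F X"]) (simp_all add: Obj_Mod)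
  qed
qed

end

theorem proposition3p21:
  fixes C :: "('o, 'm) cat" and D :: "('p, 'n) cat"
    and F :: "('o, 'm, 'p, 'n) fctr" and G :: "('p, 'n, 'o, 'm) fctr"
    and \<eta> :: "'o \<Rightarrow> 'm" and \<epsilon> :: "'p \<Rightarrow> 'n" and e :: "'p \<Rightarrow> 'n"
  assumes "adjunction C D F G \<eta> \<epsilon>"
    and "semiseparable D C G"
    and "associated_idempotent D C G e"
  shows "equivalence_up_to_retracts (GF_Free C F G \<eta> \<epsilon>) (GF_Mod C F G \<eta> \<epsilon>)
           (comp_fctr (comparison_K F G \<epsilon>) (comparison_L D F G \<epsilon>))
       \<and> equivalence_up_to_retracts (GF_Free C F G \<eta> \<epsilon>) (coidentifier D e)
           (comp_fctr (coidentifier_fctr D e) (comparison_L D F G \<epsilon>))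
       \<and> equivalent_categories (idem_completion (GF_Free C F G \<eta> \<epsilon>))
           (idem_completion (coidentifier D e))
       \<and> equivalent_categories (idem_completion (coidentifier D e))
           (idem_completion (GF_Mod C F G \<eta> \<epsilon>))"
proof -
  obtain P where P: "semiseparability_witness D C G P" "\<forall>X \<in> Obj D. e X = P X X (Idn C (Ob G X))"
    using assms(3) by (auto simp: associated_idempotent_def)
  interpret semiseparable_adjunction C D F G \<eta> \<epsilon> P e
    by (intro semiseparable_adjunction.intro semiseparable_adjunction_axioms.intro assms(1)) (use P in auto)
  show ?thesis
    using KL_equivalence_up_to_retracts HL_equivalence_up_to_retracts K\<^sub>e_equivalence_up_to_retracts
    by (auto simp: equivalence_up_to_retracts_def equivalent_categories_def)
qed

end
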